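(* Let $\gamma>0$ and let $\mathsf V$ be one of the $(\mathsf E+\mathsf R)$-valuations (1) $\mathsf V=\mathsf E+\gamma\cdot\mathsf{Var}$, or (2) $\mathsf V=\mathsf E+\gamma\cdot\mathsf{SD}$, or (3) $\mathsf V=\lambda\,(\mathsf E+\gamma\cdot\mathsf{Var})+(1-\lambda)\,\mathsf V^\nu$ with $0<\lambda\le1$ and $\nu$ increasing and strictly convex. Then, for any $\delta$ with $0<\delta<1$, the Crawford game $\mathsf G_C(\delta)$ has no $\mathsf V$-equilibrium.
   Context: The Crawford game $\mathsf G_C(\delta)$ is the 2-players game in which each player has strategies $\mathsf f_1,\mathsf f_2$ and the costs $\langle\mu_1,\mu_2\rangle$ (rows: player 1's strategy; columns: player 2's strategy) are $$\begin{pmatrix}\langle 1+\delta,\,1+\delta\rangle & \langle 1,\,1+2\delta\rangle\\ \langle 1,\,1+2\delta\rangle & \langle 1+2\delta,\,1\rangle\end{pmatrix}.$$ A mixed profile $\mathbf p=\langle p_1,p_2\rangle$ consists of probability distributions $p_i$ on $\{\mathsf f_1,\mathsf f_2\}$ and induces $\mathbf p(s_1,s_2)=p_1(s_1)p_2(s_2)$. $\mathsf E_i(\mathbf p)=\sum_{\mathbf s}\mathbf p(\mathbf s)\mu_i(\mathbf s)$, $\mathsf{Var}_i(\mathbf p)=\sum_{\mathbf s}\mathbf p(\mathbf s)(\mu_i(\mathbf s)-\mathsf E_i(\mathbf p))^2$, $\mathsf{SD}_i=\sqrt{\mathsf{Var}_i}$, and $\mathsf V^\nu_i(\mathbf p)=\nu^{-1}\big(\sum_{\mathbf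 s}\mathbf p(\mathbf s)\,\nu(\mu_i(\mathbf s))\big)$, where $\nu$ is a continuous real function on an interval containing all the costs. Players minimize: $\mathbf p$ is a $\mathsf V$-equilibrium if for each player $i$, $p_i$ minimizes $\mathsf V_i(\cdot,\mathbf p_{-i})$ over all mixed strategies of player $i$, where $\mathbf p_{-i}$ is the other player's mixed strategy. *)

theory Defs
  imports "HOL-Probability.Probability"
begin

datatype player = Player1 | Player2

text \<open>In a cost function and in a pure profile, the first component is the strategy
  of player 1 and the second one that of player 2.\<close>

type_synonym 's cost = "player \<Rightarrow> 's \<times> 's \<Rightarrow> real"
type_synonym 's mixed_profile = "player \<Rightarrow> 's pmf"

definition profile_pmf :: "'s mixed_profile \<Rightarrow> ('s \<times> 's) pmf" where
  "profile_pmf p = pair_pmf (p Player1) (p Player2)"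

text \<open>A valuation assigns a value to each player and mixed profile of a given game.\<close>

type_synonym 's valuation = "'s cost \<Rightarrow> player \<Rightarrow> 's mixed_profile \<Rightarrow> real"

definition val_E :: "'s valuation" where
  "val_E \<mu> i p = measure_pmf.expectation (profile_pmf p) (\<mu> i)"

definition val_Var :: "'s valuation" where
  "val_Var \<mu> i p = measure_pmf.variance (profile_pmf p) (\<mu> i)"

definition val_SD :: "'s valuation" where
  "val_SD \<mu> i p = sqrt (val_Var \<mu> i p)"

text \<open>The inverse of \<open>\<nu>\<close> is the one of its restriction to the interval \<open>I\<close>; outside
  \<open>I\<close> the values of the total function \<open>\<nu>\<close> are irrelevant.\<close>

definition val_nu :: "real set \<Rightarrow> (real \<Rightarrow> real) \<Rightarrow> 's valuation" where
  "val_nu I \<nu> \<mu> i p =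
     inv_into I \<nu> (measure_pmf.expectation (profile_pmf p) (\<lambda>s. \<nu> (\<mu> i s)))"

definition strictly_convex_on :: "real set \<Rightarrow> (real \<Rightarrow> real) \<Rightarrow> bool" where
  "strictly_convex_on I f \<longleftrightarrow>
     (\<forall>x\<in>I. \<forall>y\<in>I. \<forall>t. x \<noteq> y \<and> 0 < t \<and> t < 1 \<longrightarrow>
        f ((1 - t) * x + t * y) < (1 - t) * f x + t * f y)"

text \<open>Players minimize, and deviate to arbitrary mixed strategies.\<close>

definition V_equilibrium :: "'s valuation \<Rightarrow> 's cost \<Rightarrow> 's mixed_profile \<Rightarrow> bool" where
  "V_equilibrium V \<mu> p \<longleftrightarrow> (\<forall>i q. V \<mu> i p \<le> V \<mu> i (p(i := q)))"

datatype strategy = f1 | f2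

fun crawford :: "real \<Rightarrow> strategy cost" where
  "crawford \<delta> Player1 (f1, f1) = 1 + \<delta>"
| "crawford \<delta> Player1 (f1, f2) = 1"
| "crawford \<delta> Player1 (f2, f1) = 1"
| "crawford \<delta> Player1 (f2, f2) = 1 + 2 * \<delta>"
| "crawford \<delta> Player2 (f1, f1) = 1 + \<delta>"
| "crawford \<delta> Player2 (f1, f2) = 1 + 2 * \<delta>"
| "crawford \<delta> Player2 (f2, f1) = 1 + 2 * \<delta>"
| "crawford \<delta> Player2 (f2, f2) = 1"

end

theory Submission
  imports Defs
begin

text \<open>Along the mixed strategies of one player, each of the valuations is concave, and strictly so
  if the two pure strategies of this player have different expected costs: the variance of a
  mixture with weights \<open>a\<close> and \<open>1 - a\<close> exceeds the mixed variances by \<open>a * (1 - a) * (e\<^sub>1 - e\<^sub>2)\<^sup>2\<close>,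
  and the square root and the inverse of \<open>\<nu>\<close> are concave and increasing.
  So a properly mixed strategy can be optimal only if the pure ones have equal expected costs.
  For player 1 this happens only if player 2 plays \<open>f1\<close> with probability \<open>2/3\<close>, and
  then \<open>f1\<close> has a smaller variance than \<open>f2\<close> and, by convexity of \<open>\<nu>\<close>, no greater
  \<open>\<nu>\<close>-value. So player 1 plays a pure strategy, against which the
  two pure strategies of player 2 have different expected costs. So player 2 plays a pure
  strategy as well, but the game has no pure equilibrium.\<close>

section \<open>Concavity along the mixed strategies of one player\<close>

abbreviation pure_dev :: "'s mixed_profile \<Rightarrow> player \<Rightarrow> 's \<Rightarrow> 's mixed_profile" where
  "pure_dev p i s \<equiv> p(i := return_pmf s)"

abbreviation expect :: "(strategy \<times> strategy \<Rightarrow> real) \<Rightarrow> strategy mixed_profile \<Rightarrow> real" where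
  "expect f p \<equiv> measure_pmf.expectation (profile_pmf p) f"

text \<open>The chord of \<open>V\<close> over the segment of mixed strategies of player
  \<open>i\<close>, evaluated at \<open>p i\<close>. With two strategies per player, this chord
  between the end points is the only one that the equilibrium arguments compare with
  \<open>V\<close>.\<close>

definition pure_mix ::
    "strategy valuation \<Rightarrow> strategy cost \<Rightarrow> player \<Rightarrow> strategy mixed_profile \<Rightarrow> real" where
  "pure_mix V \<mu> i p =
     pmf (p i) f1 * V \<mu> i (pure_dev p i f1) + (1 - pmf (p i) f1) * V \<mu> i (pure_dev p i f2)"

definition mixing_concave :: "strategy valuation \<Rightarrow> strategy cost \<Rightarrow> bool" where
  "mixing_concave V \<mu> \<longleftrightarrow> (\<forall>i p. pure_mix V \<mu> i p \<le> V \<mu> i p)"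

definition mixing_strictly_concave :: "strategy valuation \<Rightarrow> strategy cost \<Rightarrow> bool" where
  "mixing_strictly_concave V \<mu> \<longleftrightarrow>
     (\<forall>i p. 0 < pmf (p i) f1 \<longrightarrow> pmf (p i) f1 < 1 \<longrightarrow>
        val_E \<mu> i (pure_dev p i f1) \<noteq> val_E \<mu> i (pure_dev p i f2) \<longrightarrow>
        pure_mix V \<mu> i p < V \<mu> i p)"

section \<open>Expectations over the four pure profiles\<close>

lemma UNIV_strategy: "(UNIV :: strategy set) = {f1, f2}"
  by (auto intro: strategy.exhaust)

instance strategy :: finite
  by standard (simp add: UNIV_strategy)

lemma pmf_strategy_f2: "pmf q f2 = 1 - pmf q f1"
proof -
  have "(\<Sum>s\<in>UNIV. pmf q s) = 1"
    by (rule sum_pmf_eq_1) auto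
  then show ?thesis by (simp add: UNIV_strategy)
qed

lemma pmf_strategy_eq_return:
  shows "pmf q f1 = 1 \<Longrightarrow> q = return_pmf f1" and "pmf q f1 = 0 \<Longrightarrow> q = return_pmf f2"
proof -
  show "q = return_pmf f1" if "pmf q f1 = 1"
  proof (rule pmf_eqI)
    show "pmf q s = pmf (return_pmf f1) s" for s
      using that by (cases s) (simp_all add: pmf_strategy_f2)
  qed
  show "q = return_pmf f2" if "pmf q f1 = 0"
  proof (rule pmf_eqI)
    show "pmf q s = pmf (return_pmf f2) s" for s
      using that by (cases s) (simp_all add: pmf_strategy_f2)
  qed
qed

lemma expect_eq:
  "expect f p =
     pmf (p Player1) f1 * (pmf (p Player2) f1 * f (f1, f1) + (1 - pmf (p Player2) f1) * f (f1, f2)) +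
     (1 - pmf (p Player1) f1) *
       (pmf (p Player2) f1 * f (f2, f1) + (1 - pmf (p Player2) f1) * f (f2, f2))"
proof -
  have "expect f p = (\<Sum>s\<in>UNIV. f s * pmf (profile_pmf p) s)"
    by (rule integral_measure_pmf_real) auto
  also have "\<dots> = (\<Sum>s\<in>{f1, f2} \<times> {f1, f2}. f s * pmf (profile_pmf p) s)"
    by (simp only: UNIV_Times_UNIV[symmetric] UNIV_strategy)
  finally show ?thesis
    by (simp add: sum.cartesian_product[symmetric] profile_pmf_def pmf_pair pmf_strategy_f2 algebra_simps)
qed

lemma expect_mix:
  "expect f p =
     pmf (p i) f1 * expect f (pure_dev p i f1) + (1 - pmf (p i) f1) * expect f (pure_dev p i f2)"
  by (cases i) (simp_all add: expect_eq algebra_simps)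

text \<open>By \<open>expect_eq\<close> an expectation is a convex combination of two convex
  combinations.\<close>

lemma expect_in_convex:
  assumes "convex C" and "\<And>s. f s \<in> C"
  shows "expect f p \<in> C"
proof -
  have mix: "pmf q f1 * u + (1 - pmf q f1) * v \<in> C" if "u \<in> C" "v \<in> C" for q u v
    using convexD[OF assms(1) that, of "pmf q f1" "1 - pmf q f1"] by (simp add: pmf_le_1)
  show ?thesis
    unfolding expect_eq by (intro mix assms(2))
qed

section \<open>Variance and standard deviation\<close>

lemma val_Var_eq: "val_Var \<mu> i p = expect (\<lambda>s. (\<mu> i s)\<^sup>2) p - (val_E \<mu> i p)\<^sup>2"
  unfolding val_Var_def val_E_def
  by (rule measure_pmf.variance_eq) (auto intro: integrable_measure_pmf_finite)

lemma val_Var_nonneg: "0 \<le> val_Var \<mu> i p"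
  unfolding val_Var_def by (rule measure_pmf.variance_positive)

lemma pure_mix_val_E: "pure_mix val_E \<mu> i p = val_E \<mu> i p"
  unfolding pure_mix_def val_E_def using expect_mix[of p "\<mu> i" i] by simp

text \<open>The second moment is affine in the weight \<open>a\<close> of \<open>f1\<close>, so only
  the squared mean contributes: \<open>a * x^2 + (1 - a) * y^2 - (a * x + (1 - a) * y)^2 = a * (1 -
  a) * (x - y)^2\<close>.\<close>

lemma val_Var_mix:
  "val_Var \<mu> i p = pure_mix val_Var \<mu> i p +
     pmf (p i) f1 * (1 - pmf (p i) f1) *
       (val_E \<mu> i (pure_dev p i f1) - val_E \<mu> i (pure_dev p i f2))\<^sup>2"
  unfolding pure_mix_def val_Var_eq expect_mix[of p "\<lambda>s. (\<mu> i s)\<^sup>2" i]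
    pure_mix_val_E[symmetric, of \<mu> i p]
  by (simp add: power2_eq_square algebra_simps)

lemma mixing_concave_Var: "mixing_concave val_Var \<mu>"
  by (auto simp: mixing_concave_def val_Var_mix pmf_le_1)

lemma mixing_strictly_concave_Var: "mixing_strictly_concave val_Var \<mu>"
  by (auto simp: mixing_strictly_concave_def val_Var_mix[of \<mu>])

text \<open>After squaring, the gap between the two sides is
  \<open>a * (1 - a) * (sqrt u - sqrt v)^2\<close>.\<close>

lemma sqrt_concave:
  assumes "0 \<le> a" "a \<le> 1" "0 \<le> u" "0 \<le> v"
  shows "a * sqrt u + (1 - a) * sqrt v \<le> sqrt (a * u + (1 - a) * v)"
proof (rule real_le_rsqrt)
  have "(a * sqrt u + (1 - a) * sqrt v)\<^sup>2 =
      a * (sqrt u)\<^sup>2 + (1 - a) * (sqrt v)\<^sup>2 - a * (1 - a) * (sqrt u - sqrt v)\<^sup>2"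
    by (simp add: power2_eq_square algebra_simps)
  also have "\<dots> \<le> a * u + (1 - a) * v"
    using assms by simp
  finally show "(a * sqrt u + (1 - a) * sqrt v)\<^sup>2 \<le> a * u + (1 - a) * v" .
qed

lemma pure_mix_SD_le: "pure_mix val_SD \<mu> i p \<le> sqrt (pure_mix val_Var \<mu> i p)"
  unfolding pure_mix_def val_SD_def by (intro sqrt_concave) (auto simp: pmf_le_1 val_Var_nonneg)

lemma mixing_concave_SD: "mixing_concave val_SD \<mu>"
  unfolding mixing_concave_def
proof (intro allI)
  fix i :: player and p :: "strategy mixed_profile"
  have "pure_mix val_Var \<mu> i p \<le> val_Var \<mu> i p"
    using mixing_concave_Var by (simp add: mixing_concave_def)
  then show "pure_mix val_SD \<mu> i p \<le> val_SD \<mu> i p"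
    using pure_mix_SD_le[of \<mu> i p] unfolding val_SD_def by (meson order_trans real_sqrt_le_mono)
qed

text \<open>Strictness comes from the variance under the root and not from the root itself, since
  both pure deviations may have the same variance.\<close>

lemma mixing_strictly_concave_SD: "mixing_strictly_concave val_SD \<mu>"
  unfolding mixing_strictly_concave_def
proof (intro allI impI)
  fix i :: player and p :: "strategy mixed_profile"
  assume "0 < pmf (p i) f1" "pmf (p i) f1 < 1"
    "val_E \<mu> i (pure_dev p i f1) \<noteq> val_E \<mu> i (pure_dev p i f2)"
  then have "pure_mix val_Var \<mu> i p < val_Var \<mu> i p"
    using mixing_strictly_concave_Var by (simp add: mixing_strictly_concave_def)
  then show "pure_mix val_SD \<mu> i p < val_SD \<mu> i p"
    using pure_mix_SD_le[of \<mu> i p] unfolding val_SD_def by (meson le_less_trans real_sqrt_less_mono)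
qed

section \<open>Combinations of valuations with nonnegative weights\<close>

lemma mixing_concave_lincomb:
  assumes "mixing_concave V \<mu>" "mixing_concave W \<mu>" "0 \<le> c" "0 \<le> d"
  shows "mixing_concave (\<lambda>\<mu> i p. c * V \<mu> i p + d * W \<mu> i p) \<mu>"
  unfolding mixing_concave_def
proof (intro allI)
  fix i :: player and p :: "strategy mixed_profile"
  have "c * pure_mix V \<mu> i p + d * pure_mix W \<mu> i p \<le> c * V \<mu> i p + d * W \<mu> i p"
    using assms by (intro add_mono mult_left_mono) (auto simp: mixing_concave_def)
  then show "pure_mix (\<lambda>\<mu> i p. c * V \<mu> i p + d * W \<mu> i p) \<mu> i p \<le> c * V \<mu> i p + d * W \<mu> i p"
    by (simp add: pure_mix_def algebra_simps)
qed

text \<open>One strict summand of positive weight suffices; this is how the variance term makes a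
  whole valuation strict.\<close>

lemma mixing_strictly_concave_lincomb:
  assumes "mixing_strictly_concave V \<mu>" "mixing_concave W \<mu>" "0 < c" "0 \<le> d"
  shows "mixing_strictly_concave (\<lambda>\<mu> i p. c * V \<mu> i p + d * W \<mu> i p) \<mu>"
  unfolding mixing_strictly_concave_def
proof (intro allI impI)
  fix i :: player and p :: "strategy mixed_profile"
  assume "0 < pmf (p i) f1" "pmf (p i) f1 < 1"
    "val_E \<mu> i (pure_dev p i f1) \<noteq> val_E \<mu> i (pure_dev p i f2)"
  then have "c * pure_mix V \<mu> i p + d * pure_mix W \<mu> i p < c * V \<mu> i p + d * W \<mu> i p"
    using assms by (intro add_less_le_mono mult_strict_left_mono mult_left_mono)
      (auto simp: mixing_strictly_concave_def mixing_concave_def)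
  then show "pure_mix (\<lambda>\<mu> i p. c * V \<mu> i p + d * W \<mu> i p) \<mu> i p < c * V \<mu> i p + d * W \<mu> i p"
    by (simp add: pure_mix_def algebra_simps)
qed

lemma mixing_concave_E: "mixing_concave val_E \<mu>"
  by (simp add: mixing_concave_def pure_mix_val_E)

lemma mixing_concave_E_plus:
  assumes "mixing_concave R \<mu>" "\<gamma> > 0"
  shows "mixing_concave (\<lambda>\<mu> i p. val_E \<mu> i p + \<gamma> * R \<mu> i p) \<mu>"
  using mixing_concave_lincomb[OF mixing_concave_E assms(1), of 1 \<gamma>] assms(2) by simp

lemma mixing_strictly_concave_E_plus:
  assumes "mixing_strictly_concave R \<mu>" "\<gamma> > 0"
  shows "mixing_strictly_concave (\<lambda>\<mu> i p. val_E \<mu> i p + \<gamma> * R \<mu> i p) \<mu>"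
  using mixing_strictly_concave_lincomb[OF assms(1) mixing_concave_E, of \<gamma> 1] assms(2)
  by (simp add: add.commute)

section \<open>The valuation given by \<open>\<nu>\<close>\<close>

lemma expect_nu_in_image:
  fixes I :: "real set"
  assumes "is_interval I" "\<And>i s. \<mu> i s \<in> I" "continuous_on I \<nu>"
  shows "expect (\<lambda>s. \<nu> (\<mu> i s)) p \<in> \<nu> ` I"
proof -
  \<comment> \<open>A continuous image of an interval is an interval. Hence averages of values of
    \<open>\<nu>\<close> have a preimage in \<open>I\<close>, and \<open>inv_into\<close> is a true
    inverse there.\<close>
  have "convex (\<nu> ` I)"
    using connected_continuous_image[OF assms(3)] assms(1)
    by (simp add: is_interval_connected_1 is_interval_convex_1[symmetric])
  then show ?thesis
    by (rule expect_in_convex) (use assms(2) in auto)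
qed

text \<open>Both sides are compared through \<open>\<nu>\<close>: convexity bounds
  \<open>\<nu>\<close> at the mixture by the mixture of the \<open>\<nu>\<close>-values, which is
  \<open>\<nu>\<close> of the value of \<open>p\<close> because expectation is affine in
  \<open>p i\<close>. An increasing \<open>\<nu>\<close> reflects the inequality.\<close>

lemma mixing_concave_nu:
  fixes I :: "real set"
  assumes I: "is_interval I" and \<mu>: "\<And>i s. \<mu> i s \<in> I" and \<nu>: "continuous_on I \<nu>"
    and mono: "strict_mono_on I \<nu>" and conv: "strictly_convex_on I \<nu>"
  shows "mixing_concave (val_nu I \<nu>) \<mu>"
  unfolding mixing_concave_def
proof (intro allI)
  fix i :: player and p :: "strategy mixed_profile"
  define a where "a = pmf (p i) f1"
  have a: "0 \<le> a" "a \<le> 1"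
    by (simp_all add: a_def pmf_le_1)
  have nu_in: "val_nu I \<nu> \<mu> i r \<in> I" for r
    unfolding val_nu_def by (rule inv_into_into[OF expect_nu_in_image[OF I \<mu> \<nu>]])
  have nu_eq: "\<nu> (val_nu I \<nu> \<mu> i r) = expect (\<lambda>s. \<nu> (\<mu> i s)) r" for r
    unfolding val_nu_def by (rule f_inv_into_f[OF expect_nu_in_image[OF I \<mu> \<nu>]])
  let ?u = "val_nu I \<nu> \<mu> i (pure_dev p i f1)" and ?v = "val_nu I \<nu> \<mu> i (pure_dev p i f2)"
  have mix: "pure_mix (val_nu I \<nu>) \<mu> i p = a * ?u + (1 - a) * ?v"
    by (simp add: pure_mix_def a_def)
  have "a * ?u + (1 - a) * ?v \<in> I"
    using convexD[of I ?u ?v a "1 - a"] I nu_in a by (simp add: is_interval_convex_1)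
  moreover have "\<nu> (a * ?u + (1 - a) * ?v) \<le> a * \<nu> ?u + (1 - a) * \<nu> ?v"
  proof (cases "?u = ?v \<or> a = 0 \<or> a = 1")
    case True
    then show ?thesis by (auto simp: algebra_simps)
  next
    case False
    \<comment> \<open>\<open>strictly_convex_on\<close> puts the weight \<open>t\<close> on the
      second point, so here \<open>t = 1 - a\<close>.\<close>
    have "\<nu> ((1 - (1 - a)) * ?u + (1 - a) * ?v) < (1 - (1 - a)) * \<nu> ?u + (1 - a) * \<nu> ?v"
      using conv False a nu_in unfolding strictly_convex_on_def
      by (metis diff_gt_0_iff_gt diff_less_eq less_add_same_cancel1 linorder_not_le order_antisym)
    then show ?thesis by simp
  qed
  then have "\<nu> (a * ?u + (1 - a) * ?v) \<le> \<nu> (val_nu I \<nu> \<mu> i p)"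
    unfolding nu_eq using expect_mix[of p "\<lambda>s. \<nu> (\<mu> i s)" i] by (simp add: a_def)
  ultimately show "pure_mix (val_nu I \<nu>) \<mu> i p \<le> val_nu I \<nu> \<mu> i p"
    unfolding mix using strict_mono_onD[OF mono] nu_in
    by (meson linorder_not_le)
qed

section \<open>Pure profiles and cost ties in the Crawford game\<close>

lemma expect_pure:
  assumes "p Player1 = return_pmf s" "p Player2 = return_pmf t"
  shows "expect f p = f (s, t)"
  using assms by (cases s; cases t) (simp_all add: expect_eq)

lemma val_pure:
  fixes p :: "strategy mixed_profile"
  assumes "p Player1 = return_pmf s" "p Player2 = return_pmf t"
  shows "val_E \<mu> i p = \<mu> i (s, t)" and "val_Var \<mu> i p = 0" and "val_SD \<mu> i p = 0"
    and "inj_on \<nu> I \<Longrightarrow> \<mu> i (s, t) \<in> I \<Longrightarrow> val_nu I \<nu> \<mu> i p = \<mu> i (s, t)"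
  by (simp_all add: val_SD_def val_Var_eq val_E_def val_nu_def expect_pure[OF assms])

text \<open>If player 2 plays \<open>f1\<close> with probability \<open>q\<close>, the expected
  costs of \<open>f1\<close> and \<open>f2\<close> are \<open>1 + \<delta> * q\<close> and
  \<open>1 + 2 * \<delta> * (1 - q)\<close>.\<close>

lemma crawford_equal_expectation:
  assumes "\<delta> \<noteq> 0"
    and "val_E (crawford \<delta>) Player1 (pure_dev p Player1 f1) =
         val_E (crawford \<delta>) Player1 (pure_dev p Player1 f2)"
  shows "pmf (p Player2) f1 = 2 / 3"
proof -
  have "\<delta> * (3 * pmf (p Player2) f1 - 2) = 0"
    using assms(2) by (simp add: val_E_def expect_eq algebra_simps)
  then show ?thesis using assms(1) by simp
qed

text \<open>Either strategy yields two costs with probabilities 2/3 and 1/3, at distance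
  \<open>\<delta>\<close> for \<open>f1\<close> and \<open>2 * \<delta>\<close> for
  \<open>f2\<close>.\<close>

lemma crawford_Var_less:
  assumes "\<delta> \<noteq> 0" and "pmf (p Player2) f1 = 2 / 3"
  shows "val_Var (crawford \<delta>) Player1 (pure_dev p Player1 f1)
       < val_Var (crawford \<delta>) Player1 (pure_dev p Player1 f2)"
proof -
  have "val_Var (crawford \<delta>) Player1 (pure_dev p Player1 f1) = 2 / 9 * \<delta>\<^sup>2"
    and "val_Var (crawford \<delta>) Player1 (pure_dev p Player1 f2) = 8 / 9 * \<delta>\<^sup>2"
    by (simp_all add: val_Var_eq val_E_def expect_eq assms(2)) (simp_all add: power2_eq_square field_simps)
  moreover have "0 < \<delta>\<^sup>2" using assms(1) by simp
  ultimately show ?thesis by linarith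
qed

text \<open>With weights 2/3 and 1/3 the claim reduces to \<open>2 * \<nu> (1 + \<delta>) \<le>
  \<nu> 1 + \<nu> (1 + 2 * \<delta>)\<close>, which is convexity at a midpoint.\<close>

lemma crawford_nu_le:
  assumes I: "is_interval I" and \<mu>: "\<And>i s. crawford \<delta> i s \<in> I" and \<nu>: "continuous_on I \<nu>"
    and mono: "strict_mono_on I \<nu>" and conv: "strictly_convex_on I \<nu>"
    and "\<delta> > 0" and "pmf (p Player2) f1 = 2 / 3"
  shows "val_nu I \<nu> (crawford \<delta>) Player1 (pure_dev p Player1 f1)
       \<le> val_nu I \<nu> (crawford \<delta>) Player1 (pure_dev p Player1 f2)"
proof -
  have nu_in: "val_nu I \<nu> (crawford \<delta>) i r \<in> I" for i r
    unfolding val_nu_def by (rule inv_into_into[OF expect_nu_in_image[OF I \<mu> \<nu>]])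
  have nu_eq: "\<nu> (val_nu I \<nu> (crawford \<delta>) i r) = expect (\<lambda>s. \<nu> (crawford \<delta> i s)) r" for i r
    unfolding val_nu_def by (rule f_inv_into_f[OF expect_nu_in_image[OF I \<mu> \<nu>]])
  have "1 \<in> I" "1 + 2 * \<delta> \<in> I"
    using \<mu>[of Player1 "(f1, f2)"] \<mu>[of Player1 "(f2, f2)"] by simp_all
  then have "\<nu> ((1 - 1/2) * 1 + 1/2 * (1 + 2 * \<delta>)) < (1 - 1/2) * \<nu> 1 + 1/2 * \<nu> (1 + 2 * \<delta>)"
    using \<open>\<delta> > 0\<close> by (intro conv[unfolded strictly_convex_on_def, rule_format]) auto
  then have "\<nu> (1 + \<delta>) < \<nu> 1 / 2 + \<nu> (1 + 2 * \<delta>) / 2"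
    by (simp add: algebra_simps)
  then have "\<nu> (val_nu I \<nu> (crawford \<delta>) Player1 (pure_dev p Player1 f1))
      \<le> \<nu> (val_nu I \<nu> (crawford \<delta>) Player1 (pure_dev p Player1 f2))"
    unfolding nu_eq by (simp add: expect_eq assms(7))
  then show ?thesis
    using strict_mono_onD[OF mono] nu_in by (meson linorder_not_le)
qed

section \<open>From equilibria to pure strategies\<close>

lemma V_equilibrium_pure:
  assumes "V_equilibrium V \<mu> p" and "mixing_strictly_concave V \<mu>"
    and "val_E \<mu> i (pure_dev p i f1) \<noteq> val_E \<mu> i (pure_dev p i f2)"
  shows "\<exists>s. p i = return_pmf s"
proof -
  let ?a = "pmf (p i) f1"
  have "V \<mu> i p \<le> V \<mu> i (pure_dev p i s)" for s
    using assms(1) by (simp add: V_equilibrium_def)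
  \<comment> \<open>Neither pure deviation is cheaper than \<open>p\<close>, so their average is not
    cheaper either, whereas strict concavity would put the chord below \<open>V\<close>.\<close>
  then have "?a * V \<mu> i p + (1 - ?a) * V \<mu> i p \<le> pure_mix V \<mu> i p"
    unfolding pure_mix_def by (intro add_mono mult_left_mono) (auto simp: pmf_le_1)
  then have "\<not> pure_mix V \<mu> i p < V \<mu> i p"
    by (simp add: algebra_simps)
  then have "\<not> (0 < ?a \<and> ?a < 1)"
    using assms(2,3) by (auto simp: mixing_strictly_concave_def)
  then have "?a = 0 \<or> ?a = 1"
    using pmf_nonneg[of "p i" f1] pmf_le_1[of "p i" f1] by linarith
  then show ?thesis
    using pmf_strategy_eq_return by blast
qed

lemma V_equilibrium_pure_strict:
  assumes "V_equilibrium V \<mu> p" and "mixing_concave V \<mu>"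
    and less: "V \<mu> i (pure_dev p i f1) < V \<mu> i (pure_dev p i f2)"
  shows "p i = return_pmf f1"
proof -
  let ?a = "pmf (p i) f1"
  have "pure_mix V \<mu> i p \<le> V \<mu> i p"
    using assms(2) by (simp add: mixing_concave_def)
  also have "\<dots> \<le> V \<mu> i (pure_dev p i f1)"
    using assms(1) by (simp add: V_equilibrium_def)
  finally have "(1 - ?a) * (V \<mu> i (pure_dev p i f2) - V \<mu> i (pure_dev p i f1)) \<le> 0"
    by (simp add: pure_mix_def algebra_simps)
  then have "1 \<le> ?a"
    using less by (simp add: mult_le_0_iff)
  then have "?a = 1"
    using pmf_le_1[of "p i" f1] by linarith
  then show ?thesis
    by (rule pmf_strategy_eq_return)
qed

text \<open>The assumptions collect what the three kinds of valuation share; \<open>risk\<close>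
  breaks the tie of player 1 in favour of \<open>f1\<close>.\<close>

lemma crawford_no_equilibrium:
  assumes \<delta>: "\<delta> > 0"
    and concave: "mixing_concave V (crawford \<delta>)" "mixing_strictly_concave V (crawford \<delta>)"
    and pure: "\<And>i p s t. p Player1 = return_pmf s \<Longrightarrow> p Player2 = return_pmf t \<Longrightarrow>
                 V (crawford \<delta>) i p = crawford \<delta> i (s, t)"
    and risk: "\<And>p. pmf (p Player2) f1 = 2 / 3 \<Longrightarrow>
                 val_E (crawford \<delta>) Player1 (pure_dev p Player1 f1) =
                 val_E (crawford \<delta>) Player1 (pure_dev p Player1 f2) \<Longrightarrow>
                 V (crawford \<delta>) Player1 (pure_dev p Player1 f1) <
                 V (crawford \<delta>) Player1 (pure_dev p Player1 f2)"
  shows "\<not> V_equilibrium V (crawford \<delta>) p"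
proof
  assume eq: "V_equilibrium V (crawford \<delta>) p"
  obtain s where s: "p Player1 = return_pmf s"
  proof (cases "val_E (crawford \<delta>) Player1 (pure_dev p Player1 f1) =
                val_E (crawford \<delta>) Player1 (pure_dev p Player1 f2)")
    case True
    then show ?thesis
      using V_equilibrium_pure_strict[OF eq concave(1) risk] crawford_equal_expectation[of \<delta> p] \<delta> that
      by blast
  next
    case False
    then show ?thesis
      using V_equilibrium_pure[OF eq concave(2)] that by blast
  qed
  \<comment> \<open>Player 2 never faces a tie against a pure strategy: the costs are
    \<open>1 + \<delta>\<close> and \<open>1 + 2 * \<delta>\<close> against \<open>f1\<close>, and
    \<open>1 + 2 * \<delta>\<close> and \<open>1\<close> against \<open>f2\<close>.\<close>
  have "val_E (crawford \<delta>) Player2 (pure_dev p Player2 t) = crawford \<delta> Player2 (s, t)" for t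
    using s by (simp add: val_pure(1))
  then have "val_E (crawford \<delta>) Player2 (pure_dev p Player2 f1) \<noteq>
             val_E (crawford \<delta>) Player2 (pure_dev p Player2 f2)"
    using \<delta> by (cases s) simp_all
  then obtain t where t: "p Player2 = return_pmf t"
    using V_equilibrium_pure[OF eq concave(2)] by blast
  have "\<forall>s'. crawford \<delta> Player1 (s, t) \<le> crawford \<delta> Player1 (s', t)"
  proof
    fix s'
    show "crawford \<delta> Player1 (s, t) \<le> crawford \<delta> Player1 (s', t)"
      using eq[unfolded V_equilibrium_def, rule_format, of Player1 "return_pmf s'"]
      by (simp add: pure[OF s t] pure[of _ s' t] t)
  qed
  moreover have "\<forall>t'. crawford \<delta> Player2 (s, t) \<le> crawford \<delta> Player2 (s, t')"
  proof
    fix t'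
    show "crawford \<delta> Player2 (s, t) \<le> crawford \<delta> Player2 (s, t')"
      using eq[unfolded V_equilibrium_def, rule_format, of Player2 "return_pmf t'"]
      by (simp add: pure[OF s t] pure[of _ s t'] s)
  qed
  \<comment> \<open>Profitable deviations run in a cycle: from \<open>(f1, f1)\<close> to
    \<open>(f2, f1)\<close> by player 1, to \<open>(f2, f2)\<close> by player 2, to
    \<open>(f1, f2)\<close> by player 1, and back by player 2.\<close>
  ultimately show False
    using \<delta> by (cases s; cases t) (fastforce dest: spec[of _ f1] spec[of _ f2])+
qed

theorem lemma5p11:
  fixes \<gamma> \<delta> :: real and V :: "strategy valuation"
  assumes "\<gamma> > 0"
    and "V = (\<lambda>\<mu> i p. val_E \<mu> i p + \<gamma> * val_Var \<mu> i p) \<or>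
         V = (\<lambda>\<mu> i p. val_E \<mu> i p + \<gamma> * val_SD \<mu> i p) \<or>
         (\<exists>l \<nu> I. 0 < l \<and> l \<le> 1 \<and>
            is_interval I \<and> (\<forall>i s. crawford \<delta> i s \<in> I) \<and>
            continuous_on I \<nu> \<and> strict_mono_on I \<nu> \<and> strictly_convex_on I \<nu> \<and>
            V = (\<lambda>\<mu> i p. l * (val_E \<mu> i p + \<gamma> * val_Var \<mu> i p) + (1 - l) * val_nu I \<nu> \<mu> i p))"
    and "0 < \<delta>" and "\<delta> < 1"
  shows "\<not> (\<exists>p. V_equilibrium V (crawford \<delta>) p)"
proof -
  have "\<delta> \<noteq> 0" using assms(3) by simp
  note Var_less = crawford_Var_less[OF this]
  have "\<not> V_equilibrium V (crawford \<delta>) p" for p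
    using assms(2)
  proof (elim disjE exE conjE)
    assume V: "V = (\<lambda>\<mu> i p. val_E \<mu> i p + \<gamma> * val_Var \<mu> i p)"
    show ?thesis
      unfolding V using assms(1,3)
      by (intro crawford_no_equilibrium mixing_concave_E_plus mixing_concave_Var
          mixing_strictly_concave_E_plus mixing_strictly_concave_Var)
        (auto simp: val_pure intro: Var_less)
  next
    assume V: "V = (\<lambda>\<mu> i p. val_E \<mu> i p + \<gamma> * val_SD \<mu> i p)"
    show ?thesis
      unfolding V using assms(1,3)
      by (intro crawford_no_equilibrium mixing_concave_E_plus mixing_concave_SD
          mixing_strictly_concave_E_plus mixing_strictly_concave_SD)
        (auto simp: val_pure val_SD_def intro: Var_less)
  next
    fix l \<nu> I
    assume l: "0 < l" "l \<le> 1"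
      and I: "is_interval I" and costs: "\<forall>i s. crawford \<delta> i s \<in> I" and cont: "continuous_on I \<nu>"
      and mono: "strict_mono_on I \<nu>" and conv: "strictly_convex_on I \<nu>"
      and V: "V = (\<lambda>\<mu> i p. l * (val_E \<mu> i p + \<gamma> * val_Var \<mu> i p) + (1 - l) * val_nu I \<nu> \<mu> i p)"
    note costs = costs[rule_format]
    note nu_concave = mixing_concave_nu[OF I costs cont mono conv]
    note EVar_concave = mixing_concave_E_plus[OF mixing_concave_Var \<open>\<gamma> > 0\<close>]
    note EVar_strict = mixing_strictly_concave_E_plus[OF mixing_strictly_concave_Var \<open>\<gamma> > 0\<close>]
    show ?thesis
    proof (rule crawford_no_equilibrium[OF \<open>0 < \<delta>\<close>])
      show "mixing_concave V (crawford \<delta>)"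
        unfolding V using l by (intro mixing_concave_lincomb EVar_concave nu_concave) auto
      show "mixing_strictly_concave V (crawford \<delta>)"
        unfolding V using l by (intro mixing_strictly_concave_lincomb EVar_strict nu_concave) auto
      show "V (crawford \<delta>) i p = crawford \<delta> i (s, t)"
        if "p Player1 = return_pmf s" "p Player2 = return_pmf t" for i p s t
        unfolding V using val_pure[OF that] strict_mono_on_imp_inj_on[OF mono] costs
        by (simp add: algebra_simps)
      \<comment> \<open>The expectations cancel. The variance term has the positive weight
        \<open>l * \<gamma>\<close> and gives strictness; the \<open>\<nu>\<close>-term, whose
        weight \<open>1 - l\<close> may be 0, is compared only weakly.\<close>
      show "V (crawford \<delta>) Player1 (pure_dev p Player1 f1) <
            V (crawford \<delta>) Player1 (pure_dev p Player1 f2)"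
        if "pmf (p Player2) f1 = 2 / 3"
          and "val_E (crawford \<delta>) Player1 (pure_dev p Player1 f1) =
               val_E (crawford \<delta>) Player1 (pure_dev p Player1 f2)" for p
        unfolding V
        using l assms(1) that Var_less[of p]
          crawford_nu_le[OF I costs cont mono conv assms(3), of p]
        by (intro add_less_le_mono[OF mult_strict_left_mono mult_left_mono]) simp_all
    qed
  qed
  then show ?thesis by blast
qed

end
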